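(* Let $\mathcal{C}=\{d_1,\dots,d_n\}$ be a finite set of documents and let $V$ be a finite set of semantic dimensions. Assume $q(v)\ge 0$, $\tilde{\rho}_i\ge 0$, and $d_i(v)\ge 0$ for all $v\in V$ and all $i\in\{1,\dots,n\}$. For $S\subseteq\mathcal{C}$ define $$F(S)=\sum_{v\in V} q(v)\,\max_{d_i\in S}\left[\sqrt{\tilde{\rho}_i}\,d_i(v)\right],$$ with the maximum over the empty set taken to be $0$. Let $K$ be a positive integer, let $S_{\mathrm{greedy}}$ be a set selected by the greedy algorithm under the cardinality constraint $|S|\le K$, and let $$S^\star\in\arg\max_{S\subseteq\mathcal{C},\ |S|\le K}F(S)$$ be an optimal document set under the same constraint. Then $$F(S_{\mathrm{greedy}})\ge (1-1/e)\,F(S^\star).$$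
   Context: The real number $q(v)$ is the representation value of a fixed query $q$ on dimension $v$. The real number $d_i(v)$ is the representation value of document $d_i$ on dimension $v$. The real number $\tilde{\rho}_i$ is the relevance weight of document $d_i$. Documents with different indices are distinct elements of $\mathcal{C}$, even if their representation values coincide. The marginal gain of a document $d_i$ with respect to $S\subseteq\mathcal{C}$ is $$\Delta(d_i\mid S)=\sum_{v\in V} q(v)\max\left[\sqrt{\tilde{\rho}_i}\,d_i(v)-m_S(v),\,0\right],\qquad m_S(v)=\max_{d_j\in S}\left[\sqrt{\tilde{\rho}_j}\,d_j(v)\right],$$ with $m_\emptyset(v)=0$. The greedy algorithm starts from $S=\emptyset$. At each step it adds to $S$ a document $d^\star\in\arg\max_{d_i\in\mathcal{C}\setminus S}\Delta(d_i\mid S)$, with ties broken arbitrarily. It stops when $|S|=\min(K,n)$, and its output is $S_{\mathrm{greedy}}$. The constant $e$ is the base of the natural logarithm. *)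

theory Defs
  imports Complex_Main
begin

text \<open>
  A document is identified with its index \<open>i\<close>, so documents with different indices are distinct
  even if their representation values \<open>d i v\<close> coincide.
\<close>

definition max_value ::
  "('i \<Rightarrow> real) \<Rightarrow> ('i \<Rightarrow> 'v \<Rightarrow> real) \<Rightarrow> 'i set \<Rightarrow> 'v \<Rightarrow> real" where
  "max_value \<rho> d S v = (if S = {} then 0 else Max ((\<lambda>i. sqrt (\<rho> i) * d i v) ` S))"

definition objective ::
  "'v set \<Rightarrow> ('v \<Rightarrow> real) \<Rightarrow> ('i \<Rightarrow> real) \<Rightarrow> ('i \<Rightarrow> 'v \<Rightarrow> real) \<Rightarrow> 'i set \<Rightarrow> real" where
  "objective V q \<rho> d S = (\<Sum>v\<in>V. q v * max_value \<rho> d S v)"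

definition marginal_gain ::
  "'v set \<Rightarrow> ('v \<Rightarrow> real) \<Rightarrow> ('i \<Rightarrow> real) \<Rightarrow> ('i \<Rightarrow> 'v \<Rightarrow> real) \<Rightarrow> 'i set \<Rightarrow> 'i \<Rightarrow> real" where
  "marginal_gain V q \<rho> d S i =
     (\<Sum>v\<in>V. q v * max (sqrt (\<rho> i) * d i v - max_value \<rho> d S v) 0)"

text \<open>
  The sets that some run of the greedy algorithm on the ground set \<open>C\<close> passes through; arbitrary
  tie-breaking means that every maximiser may be chosen in a step.
\<close>

inductive greedy_state ::
  "'v set \<Rightarrow> ('v \<Rightarrow> real) \<Rightarrow> ('i \<Rightarrow> real) \<Rightarrow> ('i \<Rightarrow> 'v \<Rightarrow> real) \<Rightarrow> 'i set \<Rightarrow> nat \<Rightarrow> 'i set \<Rightarrow> bool"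
  for V q \<rho> d C K where
  start: "greedy_state V q \<rho> d C K {}"
| step: "greedy_state V q \<rho> d C K S \<Longrightarrow> card S < min K (card C) \<Longrightarrow>
     is_arg_max (marginal_gain V q \<rho> d S) (\<lambda>i. i \<in> C - S) i \<Longrightarrow>
     greedy_state V q \<rho> d C K (insert i S)"

definition greedy_output ::
  "'v set \<Rightarrow> ('v \<Rightarrow> real) \<Rightarrow> ('i \<Rightarrow> real) \<Rightarrow> ('i \<Rightarrow> 'v \<Rightarrow> real) \<Rightarrow> 'i set \<Rightarrow> nat \<Rightarrow> 'i set \<Rightarrow> bool" where
  "greedy_output V q \<rho> d C K S \<longleftrightarrow> greedy_state V q \<rho> d C K S \<and> card S = min K (card C)"

end

theory Submission
  imports Defs
begin

text \<open>
  The gain of adding \<open>i\<close> to \<open>S\<close> is exactly the increase of the objective, and a set \<open>T\<close> with at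
  most \<open>K\<close> elements exceeds \<open>S\<close> by at most the sum of the gains of the elements of \<open>T - S\<close>.
  Hence each greedy step closes at least a fraction \<open>1 / K\<close> of the gap to \<open>T\<close>, and \<open>K\<close> steps
  leave a gap of at most \<open>(1 - 1 / K)\<^sup>K \<le> 1 / e\<close> times the value of \<open>T\<close>.
  If \<open>K\<close> exceeds the number of documents, greedy selects all of them and monotonicity suffices.
\<close>

text \<open>The signs are controlled only on \<open>C\<close> and \<open>V\<close>, which is why the
  lemmas below carry side conditions such as \<open>S \<subseteq> C\<close> and
  \<open>v \<in> V\<close>.\<close>

locale weighted_documents =
  fixes V :: "'v set" and q :: "'v \<Rightarrow> real"
    and \<rho> :: "'i \<Rightarrow> real" and d :: "'i \<Rightarrow> 'v \<Rightarrow> real" and C :: "'i set"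
  assumes finite_C: "finite C"
    and q_nonneg: "v \<in> V \<Longrightarrow> q v \<ge> 0"
    and \<rho>_nonneg: "i \<in> C \<Longrightarrow> \<rho> i \<ge> 0"
    and d_nonneg: "i \<in> C \<Longrightarrow> v \<in> V \<Longrightarrow> d i v \<ge> 0"
begin

lemma max_value_ge:
  assumes "S \<subseteq> C" "i \<in> S"
  shows "sqrt (\<rho> i) * d i v \<le> max_value \<rho> d S v"
  using assms finite_subset[OF assms(1) finite_C] by (auto simp: max_value_def)

lemma max_value_attained:
  assumes "S \<subseteq> C" "S \<noteq> {}"
  obtains i where "i \<in> S" "max_value \<rho> d S v = sqrt (\<rho> i) * d i v"
proof -
  have "Max ((\<lambda>i. sqrt (\<rho> i) * d i v) ` S) \<in> (\<lambda>i. sqrt (\<rho> i) * d i v) ` S"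
    using assms finite_subset[OF assms(1) finite_C] by (intro Max_in) auto
  then show thesis
    using assms that by (auto simp: max_value_def)
qed

lemma max_value_nonneg:
  assumes "S \<subseteq> C" "v \<in> V"
  shows "max_value \<rho> d S v \<ge> 0"
proof (cases "S = {}")
  case False
  then obtain i where "i \<in> S" "max_value \<rho> d S v = sqrt (\<rho> i) * d i v"
    using max_value_attained[OF assms(1)] by blast
  then show ?thesis
    using assms \<rho>_nonneg d_nonneg by auto
qed (simp add: max_value_def)

lemma max_value_mono:
  assumes "S \<subseteq> T" "T \<subseteq> C" "v \<in> V"
  shows "max_value \<rho> d S v \<le> max_value \<rho> d T v"
\<comment> \<open>\<open>Max_mono\<close> requires a nonempty smaller set; the default value 0 of
  the empty set lies below \<open>max_value\<close> of \<open>T\<close> by nonnegativity.\<close>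
proof (cases "S = {}")
  case True
  then show ?thesis
    using max_value_nonneg[OF assms(2,3)] by (simp add: max_value_def)
next
  case False
  have "finite T" using assms(2) finite_C finite_subset by blast
  then show ?thesis
    using False assms by (auto simp: max_value_def intro!: Max_mono)
qed

text \<open>Pointwise this is \<open>max a b = a + max (b - a) 0\<close>. For empty \<open>S\<close>
  the default 0 obeys the same rule because the weighted value of \<open>i\<close> is
  nonnegative.\<close>

lemma max_value_insert:
  assumes "S \<subseteq> C" "i \<in> C" "v \<in> V"
  shows "max_value \<rho> d (insert i S) v =
    max_value \<rho> d S v + max (sqrt (\<rho> i) * d i v - max_value \<rho> d S v) 0"
proof (cases "S = {}")
  case True
  then show ?thesis
    using assms \<rho>_nonneg d_nonneg by (simp add: max_value_def)
next
  case False
  have "finite S" using assms(1) finite_C finite_subset by blast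
  then show ?thesis
    using False by (simp add: max_value_def)
qed

text \<open>A single document attains the maximum over \<open>T\<close>. If it lies in
  \<open>S\<close>, the first term suffices; otherwise its own summand covers the excess, and the
  other summands are nonnegative.\<close>

lemma max_value_le_sum:
  assumes "S \<subseteq> C" "T \<subseteq> C" "v \<in> V"
  shows "max_value \<rho> d T v \<le>
    max_value \<rho> d S v + (\<Sum>i\<in>T - S. max (sqrt (\<rho> i) * d i v - max_value \<rho> d S v) 0)"
    (is "_ \<le> _ + sum ?g _")
proof (cases "T = {}")
  case True
  then show ?thesis
    using max_value_nonneg[OF assms(1,3)] by (simp add: max_value_def)
next
  case False
  then obtain i where i: "i \<in> T" "max_value \<rho> d T v = sqrt (\<rho> i) * d i v"
    using max_value_attained[OF assms(2)] by blast
  have fin: "finite (T - S)" using assms(2) finite_C finite_subset by blast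
  show ?thesis
  proof (cases "i \<in> S")
    case True
    have "0 \<le> sum ?g (T - S)" by (simp add: sum_nonneg)
    then show ?thesis
      using max_value_ge[OF assms(1) True, of v] i by linarith
  next
    case False
    have "?g i \<le> sum ?g (T - S)"
      using fin False i by (intro member_le_sum) auto
    then show ?thesis
      using i by linarith
  qed
qed

lemma objective_nonneg:
  assumes "S \<subseteq> C"
  shows "objective V q \<rho> d S \<ge> 0"
  unfolding objective_def
  using assms by (intro sum_nonneg mult_nonneg_nonneg q_nonneg max_value_nonneg)

lemma objective_mono:
  assumes "S \<subseteq> T" "T \<subseteq> C"
  shows "objective V q \<rho> d S \<le> objective V q \<rho> d T"
  unfolding objective_def
  using assms by (intro sum_mono mult_left_mono q_nonneg max_value_mono)

lemma marginal_gain_nonneg: "marginal_gain V q \<rho> d S i \<ge> 0"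
  unfolding marginal_gain_def
  by (intro sum_nonneg mult_nonneg_nonneg q_nonneg) auto

lemma objective_insert:
  assumes "S \<subseteq> C" "i \<in> C"
  shows "objective V q \<rho> d (insert i S) = objective V q \<rho> d S + marginal_gain V q \<rho> d S i"
  using assms
  by (simp add: objective_def marginal_gain_def max_value_insert distrib_left sum.distrib)

text \<open>The form in which submodularity enters: all gains are measured against the same
  \<open>S\<close>. It follows from the pointwise bound by weighting with \<open>q\<close> and
  exchanging the sums over dimensions and documents.\<close>

lemma objective_le_sum_marginal_gain:
  assumes "S \<subseteq> C" "T \<subseteq> C"
  shows "objective V q \<rho> d T \<le> objective V q \<rho> d S + (\<Sum>i\<in>T - S. marginal_gain V q \<rho> d S i)"
proof -
  have "objective V q \<rho> d T \<le> (\<Sum>v\<in>V. q v * (max_value \<rho> d S v +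
      (\<Sum>i\<in>T - S. max (sqrt (\<rho> i) * d i v - max_value \<rho> d S v) 0)))"
    unfolding objective_def
    using assms by (intro sum_mono mult_left_mono q_nonneg max_value_le_sum)
  also have "\<dots> = objective V q \<rho> d S + (\<Sum>i\<in>T - S. marginal_gain V q \<rho> d S i)"
    unfolding objective_def marginal_gain_def
    by (subst sum.swap) (simp add: distrib_left sum.distrib sum_distrib_left)
  finally show ?thesis .
qed

text \<open>An averaging argument: the gap to \<open>T\<close> is covered by at most
  \<open>K\<close> gains, none larger than that of the greedy choice \<open>i\<close>, so
  \<open>i\<close> alone gains at least a \<open>K\<close>-th of the gap.\<close>

lemma greedy_step_gap:
  assumes "S \<subseteq> C" "T \<subseteq> C" "card T \<le> K" "K > 0"
    and "is_arg_max (marginal_gain V q \<rho> d S) (\<lambda>i. i \<in> C - S) i"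
  shows "objective V q \<rho> d T - objective V q \<rho> d (insert i S)
    \<le> (1 - 1 / K) * (objective V q \<rho> d T - objective V q \<rho> d S)"
proof -
  let ?\<Delta> = "marginal_gain V q \<rho> d S"
  have i: "i \<in> C" and best: "\<And>j. j \<in> C - S \<Longrightarrow> ?\<Delta> j \<le> ?\<Delta> i"
    using assms(5) by (auto simp: is_arg_max_linorder)
  have "finite T" using assms(2) finite_C finite_subset by blast
  then have "card (T - S) \<le> K"
    using assms(3) card_mono[of T "T - S"] by auto
  have "(\<Sum>j\<in>T - S. ?\<Delta> j) \<le> card (T - S) * ?\<Delta> i"
    using best assms(2) by (intro sum_bounded_above) auto
  also have "\<dots> \<le> K * ?\<Delta> i"
    using \<open>card (T - S) \<le> K\<close> marginal_gain_nonneg by (intro mult_right_mono) auto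
  finally have "objective V q \<rho> d T - objective V q \<rho> d S \<le> K * ?\<Delta> i"
    using objective_le_sum_marginal_gain[OF assms(1,2)] by linarith
  then have "(objective V q \<rho> d T - objective V q \<rho> d S) / K \<le> ?\<Delta> i"
    using assms(4) by (simp add: divide_le_eq mult.commute)
  then show ?thesis
    using objective_insert[OF assms(1) i] by (simp add: algebra_simps diff_divide_distrib)
qed

lemma greedy_state_subset:
  assumes "greedy_state V q \<rho> d C K S"
  shows "S \<subseteq> C"
  using assms by induction (auto simp: is_arg_max_def)

text \<open>Induction along the run: the empty set has value 0, so the initial gap is the whole
  value of \<open>T\<close>, and every step contributes one factor.\<close>

lemma greedy_state_gap:
  assumes "greedy_state V q \<rho> d C K S" "T \<subseteq> C" "card T \<le> K" "K > 0"
  shows "objective V q \<rho> d T - objective V q \<rho> d S \<le> (1 - 1 / K) ^ card S * objective V q \<rho> d T"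
  using assms(1)
proof induction
  case start
  show ?case by (simp add: objective_def max_value_def)
next
  case (step S i)
  have S: "S \<subseteq> C" using step.hyps(1) by (rule greedy_state_subset)
  then have "finite S" using finite_C finite_subset by blast
  \<comment> \<open>The chosen document is new, so the cardinality, and with it the exponent, grows
    by exactly one.\<close>
  have "i \<notin> S" using step.hyps(3) by (auto simp: is_arg_max_def)
  have "objective V q \<rho> d T - objective V q \<rho> d (insert i S)
      \<le> (1 - 1 / K) * (objective V q \<rho> d T - objective V q \<rho> d S)"
    using greedy_step_gap[OF S assms(2-4) step.hyps(3)] .
  \<comment> \<open>The factor \<open>1 - 1 / K\<close> is nonnegative because \<open>K\<close> is
    at least 1.\<close>
  also have "\<dots> \<le> (1 - 1 / K) * ((1 - 1 / K) ^ card S * objective V q \<rho> d T)"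
    using step.IH assms(4) by (intro mult_left_mono) auto
  also have "\<dots> = (1 - 1 / K) ^ card (insert i S) * objective V q \<rho> d T"
    using \<open>finite S\<close> \<open>i \<notin> S\<close> by simp
  finally show ?case .
qed

theorem greedy_output_approximation:
  assumes "greedy_output V q \<rho> d C K S" "T \<subseteq> C" "card T \<le> K" "K > 0"
  shows "objective V q \<rho> d S \<ge> (1 - 1 / exp 1) * objective V q \<rho> d T"
proof -
  have state: "greedy_state V q \<rho> d C K S" and card: "card S = min K (card C)"
    using assms(1) by (auto simp: greedy_output_def)
  have S: "S \<subseteq> C" using state by (rule greedy_state_subset)
  have nonneg: "objective V q \<rho> d T \<ge> 0" using assms(2) by (rule objective_nonneg)
  show ?thesis
  proof (cases "K \<le> card C")
    case True
    \<comment> \<open>This is \<open>1 + x \<le> exp x\<close> at \<open>x = - (1 / K)\<close>,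
      raised to the power \<open>K\<close>; the base on the left is nonnegative.\<close>
    have "(1 - 1 / K) ^ K \<le> exp (- (1 / K)) ^ K"
      using assms(4) exp_ge_add_one_self[of "- (1 / K)"] by (intro power_mono) auto
    also have "\<dots> = 1 / exp (1 :: real)"
      using assms(4) exp_of_nat_mult[of K "- (1 / K) :: real"]
      by (simp add: exp_minus inverse_eq_divide)
    finally have "(1 - 1 / K) ^ K * objective V q \<rho> d T \<le> 1 / exp 1 * objective V q \<rho> d T"
      using nonneg by (intro mult_right_mono)
    then show ?thesis
      using greedy_state_gap[OF state assms(2-4)] card True by (simp add: left_diff_distrib)
  next
    case False
    \<comment> \<open>Here \<open>min K (card C)\<close> is \<open>card C\<close>, and a subset of
      the finite set \<open>C\<close> with full cardinality is \<open>C\<close> itself.\<close>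
    then have "S = C" using S card finite_C by (intro card_subset_eq) auto
    have "(1 - 1 / exp 1) * objective V q \<rho> d T \<le> objective V q \<rho> d T"
      using nonneg by (simp add: left_diff_distrib)
    also have "\<dots> \<le> objective V q \<rho> d S"
      unfolding \<open>S = C\<close> using assms(2) by (intro objective_mono) auto
    finally show ?thesis .
  qed
qed

end

theorem corollary3p2:
  fixes n K :: nat
    and V :: "'v set"
    and q :: "'v \<Rightarrow> real"
    and \<rho> :: "nat \<Rightarrow> real"
    and d :: "nat \<Rightarrow> 'v \<Rightarrow> real"
    and S_greedy S_star :: "nat set"
  assumes "finite V"
    and "\<And>v. v \<in> V \<Longrightarrow> q v \<ge> 0"
    and "\<And>i. i \<in> {1..n} \<Longrightarrow> \<rho> i \<ge> 0"
    and "\<And>i v. i \<in> {1..n} \<Longrightarrow> v \<in> V \<Longrightarrow> d i v \<ge> 0"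
    and "K > 0"
    and "greedy_output V q \<rho> d {1..n} K S_greedy"
    and "is_arg_max (objective V q \<rho> d) (\<lambda>S. S \<subseteq> {1..n} \<and> card S \<le> K) S_star"
  shows "objective V q \<rho> d S_greedy \<ge> (1 - 1 / exp 1) * objective V q \<rho> d S_star"
proof -
  interpret weighted_documents V q \<rho> d "{1..n}"
    using assms by unfold_locales auto
  \<comment> \<open>An optimal \<open>S_star\<close> is in particular feasible, so it can serve as
    the comparison set \<open>T\<close>.\<close>
  show ?thesis
    using assms by (intro greedy_output_approximation) (auto simp: is_arg_max_def)
qed

end
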